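(* Let $G$ be a finite group, $n\ge1$, and let $\omega\in Z^2(G,\mu_n)$ be a 2-cocycle. The complex vector space spanned by all modified cocyclic matrices with respect to $G$ and $\omega$ is a $\mathbb C^*$-algebra (with respect to matrix multiplication and conjugate-transpose) of dimension $|G|$ over $\mathbb C$.
   Context: $\mu_n\subset\mathbb C^\times$ is the group of $n$-th roots of unity with trivial $G$-action, $\mu_n^+=\{0\}\cup\mu_n$. A 2-cocycle is a function $\omega:G\times G\to\mu_n$ with $\omega(g_2,g_3)\,\omega(g_1g_2,g_3)^{-1}\,\omega(g_1,g_2g_3)\,\omega(g_1,g_2)^{-1}=1$ for all $g_1,g_2,g_3\in G$. A modified cocyclic matrix with respect to $G$ and $\omega$ is a $G\times G$ matrix of the form $K\circ C'(\omega)$ ($\circ$ is the entrywise product), where $K$ is a $G\times G$ matrix over $\mu_n^+$ that is $G$-invariant, i.e. $K_{gx,gy}=K_{x,y}$ for all $g,x,y\in G$, and $C'(\omega)_{x,y}=\omega(x^{-1},y)/\omega(y^{-1},y)$ for all $x,y\in G$. *)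

theory Defs
  imports "HOL-Analysis.Analysis" "HOL-Algebra.Group"
begin

section \<open>C*-algebras\<close>

text \<open>
  The algebra is the subset \<open>A\<close> of an ambient complex vector space; all operations are
  required to be well behaved on \<open>A\<close> only.  No unit is required.
\<close>

locale cstar_algebra_on = vector_space scale
  for scale :: "complex \<Rightarrow> 'b::ab_group_add \<Rightarrow> 'b"  (infixr \<open>*\<^sub>C\<close> 75) +
  fixes A :: "'b set"
    and mul :: "'b \<Rightarrow> 'b \<Rightarrow> 'b"  (infixl \<open>\<odot>\<close> 70)
    and star :: "'b \<Rightarrow> 'b"
    and nrm :: "'b \<Rightarrow> real"
  assumes subspace_A: "subspace A"
    and mul_closed: "\<lbrakk>a \<in> A; b \<in> A\<rbrakk> \<Longrightarrow> a \<odot> b \<in> A"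
    and mul_assoc: "\<lbrakk>a \<in> A; b \<in> A; c \<in> A\<rbrakk> \<Longrightarrow> (a \<odot> b) \<odot> c = a \<odot> (b \<odot> c)"
    and mul_add_left: "\<lbrakk>a \<in> A; b \<in> A; c \<in> A\<rbrakk> \<Longrightarrow> (a + b) \<odot> c = a \<odot> c + b \<odot> c"
    and mul_add_right: "\<lbrakk>a \<in> A; b \<in> A; c \<in> A\<rbrakk> \<Longrightarrow> a \<odot> (b + c) = a \<odot> b + a \<odot> c"
    and mul_scale_left: "\<lbrakk>a \<in> A; b \<in> A\<rbrakk> \<Longrightarrow> (z *\<^sub>C a) \<odot> b = z *\<^sub>C (a \<odot> b)"
    and mul_scale_right: "\<lbrakk>a \<in> A; b \<in> A\<rbrakk> \<Longrightarrow> a \<odot> (z *\<^sub>C b) = z *\<^sub>C (a \<odot> b)"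
    and star_closed: "a \<in> A \<Longrightarrow> star a \<in> A"
    and star_star: "a \<in> A \<Longrightarrow> star (star a) = a"
    and star_add: "\<lbrakk>a \<in> A; b \<in> A\<rbrakk> \<Longrightarrow> star (a + b) = star a + star b"
    and star_scale: "a \<in> A \<Longrightarrow> star (z *\<^sub>C a) = cnj z *\<^sub>C star a"
    and star_mul: "\<lbrakk>a \<in> A; b \<in> A\<rbrakk> \<Longrightarrow> star (a \<odot> b) = star b \<odot> star a"
    and nrm_nonneg: "a \<in> A \<Longrightarrow> 0 \<le> nrm a"
    and nrm_eq_0_iff: "a \<in> A \<Longrightarrow> nrm a = 0 \<longleftrightarrow> a = 0"
    and nrm_triangle: "\<lbrakk>a \<in> A; b \<in> A\<rbrakk> \<Longrightarrow> nrm (a + b) \<le> nrm a + nrm b"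
    and nrm_scale: "a \<in> A \<Longrightarrow> nrm (z *\<^sub>C a) = cmod z * nrm a"
    and nrm_mul: "\<lbrakk>a \<in> A; b \<in> A\<rbrakk> \<Longrightarrow> nrm (a \<odot> b) \<le> nrm a * nrm b"
    and nrm_complete:
      "\<lbrakk>\<And>k. s k \<in> A; \<And>e. e > 0 \<Longrightarrow> \<exists>N::nat. \<forall>i\<ge>N. \<forall>j\<ge>N. nrm (s i - s j) < e\<rbrakk>
        \<Longrightarrow> \<exists>a\<in>A. (\<lambda>k. nrm (s k - a)) \<longlonglongrightarrow> 0"
    and cstar_identity: "a \<in> A \<Longrightarrow> nrm (star a \<odot> a) = (nrm a)\<^sup>2"


section \<open>Complex square matrices\<close>

definition cmat_scale :: "complex \<Rightarrow> complex^'i^'j \<Rightarrow> complex^'i^'j" where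
  "cmat_scale z M = (\<chi> x y. z * M $ x $ y)"

global_interpretation cmat: vector_space cmat_scale
  by unfold_locales (simp_all add: cmat_scale_def vec_eq_iff algebra_simps)

definition conj_transpose :: "complex^'i^'j \<Rightarrow> complex^'j^'i" where
  "conj_transpose M = (\<chi> x y. cnj (M $ y $ x))"

text \<open>Operator norm with respect to the Euclidean norm on column vectors.\<close>

definition op_norm :: "complex^'i::finite^'j::finite \<Rightarrow> real" where
  "op_norm M = onorm (\<lambda>v. M *v v)"

definition entrywise_mult :: "complex^'i^'j \<Rightarrow> complex^'i^'j \<Rightarrow> complex^'i^'j" where
  "entrywise_mult M N = (\<chi> x y. M $ x $ y * N $ x $ y)"


section \<open>Modified cocyclic matrices\<close>

definition roots_mu :: "nat \<Rightarrow> complex set" where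
  "roots_mu n = {z. z ^ n = 1}"

definition roots_mu_plus :: "nat \<Rightarrow> complex set" where
  "roots_mu_plus n = {0} \<union> roots_mu n"

definition two_cocycles :: "'g monoid \<Rightarrow> nat \<Rightarrow> ('g \<Rightarrow> 'g \<Rightarrow> complex) set" where
  "two_cocycles G n = {\<omega>.
     (\<forall>g\<in>carrier G. \<forall>h\<in>carrier G. \<omega> g h \<in> roots_mu n) \<and>
     (\<forall>g1\<in>carrier G. \<forall>g2\<in>carrier G. \<forall>g3\<in>carrier G.
        \<omega> g2 g3 * inverse (\<omega> (g1 \<otimes>\<^bsub>G\<^esub> g2) g3) * \<omega> g1 (g2 \<otimes>\<^bsub>G\<^esub> g3) * inverse (\<omega> g1 g2) = 1)}"

text \<open>
  From here on the rows and columns of a \<open>G \<times> G\<close> matrix are indexed by the whole finite type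
  \<open>'g\<close>; the definitions are meant for groups with \<open>carrier G = UNIV\<close>.
\<close>

definition G_invariant :: "'g monoid \<Rightarrow> complex^'g^'g \<Rightarrow> bool" where
  "G_invariant G K \<longleftrightarrow> (\<forall>g\<in>carrier G. \<forall>x\<in>carrier G. \<forall>y\<in>carrier G.
     K $ (g \<otimes>\<^bsub>G\<^esub> x) $ (g \<otimes>\<^bsub>G\<^esub> y) = K $ x $ y)"

definition C'_matrix :: "'g monoid \<Rightarrow> ('g \<Rightarrow> 'g \<Rightarrow> complex) \<Rightarrow> complex^'g^'g" where
  "C'_matrix G \<omega> = (\<chi> x y. \<omega> (inv\<^bsub>G\<^esub> x) y / \<omega> (inv\<^bsub>G\<^esub> y) y)"

definition modified_cocyclic ::
  "'g monoid \<Rightarrow> nat \<Rightarrow> ('g \<Rightarrow> 'g \<Rightarrow> complex) \<Rightarrow> (complex^'g^'g) set" where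
  "modified_cocyclic G n \<omega> = {entrywise_mult K (C'_matrix G \<omega>) | K.
     (\<forall>x y. K $ x $ y \<in> roots_mu_plus n) \<and> G_invariant G K}"

end

theory Submission
  imports Defs
begin

text \<open>
  Write \<open>C = C'_matrix G \<omega>\<close> and, for \<open>g \<in> G\<close>, let \<open>P\<^sub>g\<close> be the unitary monomial matrix with entry
  \<open>d\<^sub>g(x) = \<omega>(x\<inverse>, g\<inverse>)\<close> in position \<open>(x, g x)\<close>.  Two instances of the cocycle identity give
  \<open>d\<^sub>g(x) C(g x, g y) = C(x, y) d\<^sub>g(y)\<close> (lemma \<open>C'_matrix_translate\<close>), which says that \<open>C\<close> commutes
  with every \<open>P\<^sub>g\<close>.  As the entries of \<open>C\<close> do not vanish, every matrix can be written \<open>K \<circ> C\<close>, and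
  it commutes with all \<open>P\<^sub>g\<close> exactly if \<open>K\<close> is \<open>G\<close>-invariant.

  Hence the matrices \<open>K \<circ> C\<close> with \<open>K\<close> invariant form the commutant of a set of unitary matrices.
  Such a commutant is a linear subspace closed under products and adjoints, and any subspace of
  this kind is a C*-algebra: the C*-identity holds for all matrices, and completeness
  is a matter of finite dimension, where the operator norm is equivalent to the Euclidean one.

  An invariant \<open>K\<close> is determined by the function \<open>g \<mapsto> K(1, g)\<close>, which is arbitrary.
  The indicator functions of single elements of \<open>G\<close> give invariant matrices over \<open>{0, 1}\<close>, thus
  modified cocyclic matrices; there are \<open>|G|\<close> of them, and they form a basis of the commutant.
  So the span is the whole commutant and has dimension \<open>|G|\<close>.
\<close>

section \<open>Bilinearity of the matrix product\<close>

lemma matrix_mult_add_left: "(A + B) ** C = A ** C + B ** (C::'a::semiring_1^'k^'n)"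
  by (simp add: matrix_matrix_mult_def vec_eq_iff sum.distrib distrib_right)

lemma cmat_scale_mult_left: "cmat_scale z M ** N = cmat_scale z (M ** N)"
  by (simp add: cmat_scale_def matrix_matrix_mult_def vec_eq_iff sum_distrib_left mult.assoc)

lemma cmat_scale_mult_right: "M ** cmat_scale z N = cmat_scale z (M ** N)"
  by (simp add: cmat_scale_def matrix_matrix_mult_def vec_eq_iff sum_distrib_left mult.left_commute)


section \<open>The operator norm of complex matrices\<close>

lemma bounded_linear_matrix_vector_mult: "bounded_linear (\<lambda>v. (M::complex^'i::finite^'j::finite) *v v)"
  by (rule matrix_vector_mul_bounded_linear)

lemma norm_matrix_vector_le_op_norm: "norm (M *v v) \<le> op_norm M * norm v"
  unfolding op_norm_def by (rule onorm[OF bounded_linear_matrix_vector_mult])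

lemma op_norm_nonneg: "0 \<le> op_norm M"
  unfolding op_norm_def by (rule onorm_pos_le[OF bounded_linear_matrix_vector_mult])

lemma op_norm_le: "(\<And>v. norm (M *v v) \<le> b * norm v) \<Longrightarrow> op_norm M \<le> b"
  unfolding op_norm_def by (rule onorm_le)

lemma op_norm_eq_0_iff: "op_norm M = 0 \<longleftrightarrow> M = 0"
  unfolding op_norm_def onorm_eq_0[OF bounded_linear_matrix_vector_mult]
  using matrix_eq[of M 0] by simp

lemma op_norm_triangle: "op_norm (M + N) \<le> op_norm M + op_norm N"
  unfolding op_norm_def matrix_vector_mult_add_rdistrib
  by (rule onorm_triangle[OF bounded_linear_matrix_vector_mult bounded_linear_matrix_vector_mult])

lemma op_norm_mult: "op_norm (M ** N) \<le> op_norm M * op_norm N"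
proof -
  have "(\<lambda>v. (M ** N) *v v) = (\<lambda>v. M *v v) \<circ> (\<lambda>v. N *v v)"
    by (simp add: fun_eq_iff matrix_vector_mul_assoc)
  then show ?thesis
    unfolding op_norm_def
    using onorm_compose[OF bounded_linear_matrix_vector_mult[of M] bounded_linear_matrix_vector_mult[of N]]
    by simp
qed

lemma op_norm_scale: "op_norm (cmat_scale z M) = cmod z * op_norm M"
proof -
  have scale_mult: "cmat_scale z M *v v = z *s (M *v v)" for v
    by (simp add: cmat_scale_def matrix_vector_mult_def vec_eq_iff sum_distrib_left mult.assoc)
  have norm_scale: "norm (z *s w) = cmod z * norm w" for w :: "complex^'j::finite"
    by (simp add: norm_vec_def norm_mult L2_set_right_distrib)
  show ?thesis
  proof (rule antisym)
    show "op_norm (cmat_scale z M) \<le> cmod z * op_norm M"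
      by (rule op_norm_le)
        (simp add: scale_mult norm_scale mult.assoc mult_left_mono norm_matrix_vector_le_op_norm)
  next
    show "cmod z * op_norm M \<le> op_norm (cmat_scale z M)"
    proof (cases "z = 0")
      case False
      have "op_norm M \<le> op_norm (cmat_scale z M) / cmod z"
      proof (rule op_norm_le)
        fix v
        have "cmod z * norm (M *v v) \<le> op_norm (cmat_scale z M) * norm v"
          using norm_matrix_vector_le_op_norm[of "cmat_scale z M" v] by (simp add: scale_mult norm_scale)
        then show "norm (M *v v) \<le> op_norm (cmat_scale z M) / cmod z * norm v"
          using False by (simp add: field_simps)
      qed
      then show ?thesis
        using False by (simp add: field_simps)
    qed (simp add: op_norm_nonneg)
  qed
qed

lemma inner_matrix_vector_conj_transpose:
  fixes M :: "complex^'i::finite^'j::finite"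
  shows "(M *v v) \<bullet> w = v \<bullet> (conj_transpose M *v w)"
proof -
  have entry: "(m * a) \<bullet> b = a \<bullet> (cnj m * b)" for m a b :: complex
    by (simp add: inner_complex_def algebra_simps)
  have "(M *v v) \<bullet> w = (\<Sum>j\<in>UNIV. \<Sum>i\<in>UNIV. (M $ j $ i * v $ i) \<bullet> w $ j)"
    by (simp add: inner_vec_def matrix_vector_mult_def inner_sum_left)
  also have "\<dots> = (\<Sum>i\<in>UNIV. \<Sum>j\<in>UNIV. v $ i \<bullet> (cnj (M $ j $ i) * w $ j))"
    by (subst sum.swap) (simp add: entry)
  also have "\<dots> = v \<bullet> (conj_transpose M *v w)"
    by (simp add: inner_vec_def matrix_vector_mult_def inner_sum_right conj_transpose_def)
  finally show ?thesis .
qed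

lemma conj_transpose_conj_transpose [simp]: "conj_transpose (conj_transpose M) = M"
  by (simp add: conj_transpose_def vec_eq_iff)

lemma conj_transpose_mult: "conj_transpose (M ** N) = conj_transpose N ** conj_transpose M"
  by (simp add: conj_transpose_def matrix_matrix_mult_def vec_eq_iff mult.commute)

text \<open>
  Cauchy-Schwarz applied to \<open>\<parallel>M v\<parallel>\<^sup>2 = \<langle>v, M\<^sup>* M v\<rangle>\<close>.
\<close>

lemma op_norm_square_le: "(op_norm M)\<^sup>2 \<le> op_norm (conj_transpose M ** M)"
proof -
  let ?b = "op_norm (conj_transpose M ** M)"
  have "norm (M *v v) \<le> sqrt ?b * norm v" for v
  proof -
    have "(norm (M *v v))\<^sup>2 = v \<bullet> ((conj_transpose M ** M) *v v)"
      by (simp add: power2_norm_eq_inner inner_matrix_vector_conj_transpose matrix_vector_mul_assoc)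
    also have "\<dots> \<le> norm v * norm ((conj_transpose M ** M) *v v)"
      by (rule norm_cauchy_schwarz)
    also have "\<dots> \<le> norm v * (?b * norm v)"
      by (intro mult_left_mono norm_matrix_vector_le_op_norm) simp
    also have "\<dots> = (sqrt ?b * norm v)\<^sup>2"
      by (simp add: power_mult_distrib op_norm_nonneg power2_eq_square[of "norm v"])
    finally show ?thesis
      by (rule power2_le_imp_le) (simp add: op_norm_nonneg)
  qed
  then have "op_norm M \<le> sqrt ?b"
    by (rule op_norm_le)
  then show ?thesis
    using op_norm_nonneg real_le_rsqrt sqrt_ge_absD by (metis abs_of_nonneg)
qed

lemma op_norm_le_op_norm_conj_transpose: "op_norm M \<le> op_norm (conj_transpose M)"
proof (cases "op_norm M = 0")
  case False
  have "op_norm M * op_norm M \<le> op_norm (conj_transpose M) * op_norm M"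
    using order_trans[OF op_norm_square_le op_norm_mult] by (simp add: power2_eq_square)
  then show ?thesis
    using False op_norm_nonneg[of M] by simp
qed (simp add: op_norm_nonneg)

lemma op_norm_conj_transpose: "op_norm (conj_transpose M) = op_norm M"
  using op_norm_le_op_norm_conj_transpose[of M]
    op_norm_le_op_norm_conj_transpose[of "conj_transpose M"] by simp

lemma op_norm_cstar_identity: "op_norm (conj_transpose M ** M) = (op_norm M)\<^sup>2"
  using op_norm_square_le[of M] op_norm_mult[of "conj_transpose M" M]
  by (simp add: op_norm_conj_transpose power2_eq_square)

text \<open>
  The norm of the type \<open>complex^'i^'j\<close> is the Frobenius norm.  This and the next estimate, which are
  wasteful but enough, show that it is equivalent to the operator norm.
\<close>

lemma op_norm_le_norm:
  fixes M :: "complex^'i::finite^'j::finite"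
  shows "op_norm M \<le> norm M"
proof (rule op_norm_le)
  fix v
  have "norm ((M *v v) $ j) \<le> norm v * norm (M $ j)" for j
  proof -
    have "norm ((M *v v) $ j) \<le> (\<Sum>i\<in>UNIV. \<bar>norm (M $ j $ i)\<bar> * \<bar>norm (v $ i)\<bar>)"
      unfolding matrix_vector_mult_def by (simp add: sum_norm_le norm_mult)
    also have "\<dots> \<le> norm (M $ j) * norm v"
      unfolding norm_vec_def by (rule L2_set_mult_ineq)
    finally show ?thesis
      by (simp add: mult.commute)
  qed
  then have "norm (M *v v) \<le> L2_set (\<lambda>j. norm v * norm (M $ j)) UNIV"
    unfolding norm_vec_def[of "M *v v"] by (intro L2_set_mono) auto
  also have "\<dots> = norm M * norm v"
    by (simp add: norm_vec_def[of M] L2_set_right_distrib mult.commute)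
  finally show "norm (M *v v) \<le> norm M * norm v" .
qed

lemma norm_le_op_norm:
  fixes M :: "complex^'i::finite^'j::finite"
  shows "norm M \<le> real CARD('j) * real CARD('i) * op_norm M"
proof -
  have entry: "cmod (M $ j $ i) \<le> op_norm M" for i j
  proof -
    have "M $ j $ i = (M *v axis i 1) $ j"
      by (simp add: matrix_vector_mult_def axis_def if_distrib[of "\<lambda>c. _ * c"] cong: if_cong)
    then have "cmod (M $ j $ i) \<le> norm (M *v axis i 1)"
      by (metis Finite_Cartesian_Product.norm_nth_le)
    also have "\<dots> \<le> op_norm M * norm (axis i 1 :: complex^'i)"
      by (rule norm_matrix_vector_le_op_norm)
    finally show ?thesis
      by (simp add: norm_eq_sqrt_inner inner_axis_axis)
  qed
  have "norm M \<le> (\<Sum>j\<in>UNIV. norm (M $ j))"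
    unfolding norm_vec_def[of M] by (rule L2_set_le_sum) simp
  also have "\<dots> \<le> (\<Sum>j\<in>(UNIV::'j set). \<Sum>i\<in>(UNIV::'i set). cmod (M $ j $ i))"
    unfolding norm_vec_def[of "M $ _"] by (intro sum_mono L2_set_le_sum) simp
  also have "\<dots> \<le> (\<Sum>j\<in>(UNIV::'j set). \<Sum>i\<in>(UNIV::'i set). op_norm M)"
    by (intro sum_mono entry)
  finally show ?thesis
    by simp
qed


section \<open>Self-adjoint matrix algebras are C*-algebras\<close>

lemma closed_cmat_subspace:
  fixes A :: "(complex^'i::finite^'j::finite) set"
  assumes "cmat.subspace A"
  shows "closed A"
proof (rule closed_subspace)
  have "r *\<^sub>R M = cmat_scale (of_real r) M" for r and M :: "complex^'i^'j"
    unfolding cmat_scale_def vec_eq_iff by (simp add: scaleR_conv_of_real[where 'a=complex])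
  then show "subspace A"
    using assms by (simp add: subspace_def cmat.subspace_def)
qed

lemma op_norm_Cauchy_convergent:
  fixes s :: "nat \<Rightarrow> complex^'i::finite^'j::finite"
  assumes Cauchy: "\<And>e. e > 0 \<Longrightarrow> \<exists>N. \<forall>i\<ge>N. \<forall>j\<ge>N. op_norm (s i - s j) < e"
  obtains a where "s \<longlonglongrightarrow> a" and "(\<lambda>k. op_norm (s k - a)) \<longlonglongrightarrow> 0"
proof -
  let ?c = "real CARD('j) * real CARD('i)"
  have "Cauchy s"
  proof (rule metric_CauchyI)
    fix e :: real
    assume "e > 0"
    then obtain N where N: "\<forall>i\<ge>N. \<forall>j\<ge>N. op_norm (s i - s j) < e / ?c"
      using Cauchy[of "e / ?c"] by auto
    have "dist (s i) (s j) < e" if "i \<ge> N" "j \<ge> N" for i j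
    proof -
      have "dist (s i) (s j) \<le> ?c * op_norm (s i - s j)"
        unfolding dist_norm by (rule norm_le_op_norm)
      also have "\<dots> < ?c * (e / ?c)"
        using N that by (intro mult_strict_left_mono) auto
      finally show ?thesis
        by simp
    qed
    then show "\<exists>N. \<forall>i\<ge>N. \<forall>j\<ge>N. dist (s i) (s j) < e"
      by blast
  qed
  then obtain a where a: "s \<longlonglongrightarrow> a"
    by (auto simp: Cauchy_convergent_iff convergent_def)
  then have "(\<lambda>k. norm (s k - a)) \<longlonglongrightarrow> 0"
    using LIM_zero tendsto_norm_zero by blast
  then have "(\<lambda>k. op_norm (s k - a)) \<longlonglongrightarrow> 0"
    by (rule tendsto_sandwich[OF _ _ tendsto_const, rotated 2])
      (simp_all add: op_norm_nonneg op_norm_le_norm)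
  with a that show ?thesis
    by blast
qed

lemma cstar_algebra_on_cmat:
  fixes A :: "(complex^'i::finite^'i) set"
  assumes A: "cmat.subspace A"
    and mult: "\<And>M N. \<lbrakk>M \<in> A; N \<in> A\<rbrakk> \<Longrightarrow> M ** N \<in> A"
    and adjoint: "\<And>M. M \<in> A \<Longrightarrow> conj_transpose M \<in> A"
  shows "cstar_algebra_on cmat_scale A (**) conj_transpose op_norm"
proof unfold_locales
  fix s :: "nat \<Rightarrow> complex^'i^'i"
  assume s: "\<And>k. s k \<in> A"
    and Cauchy: "\<And>e. e > 0 \<Longrightarrow> \<exists>N. \<forall>i\<ge>N. \<forall>j\<ge>N. op_norm (s i - s j) < e"
  obtain a where a: "s \<longlonglongrightarrow> a" "(\<lambda>k. op_norm (s k - a)) \<longlonglongrightarrow> 0"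
    using op_norm_Cauchy_convergent[OF Cauchy] by blast
  have "a \<in> A"
    using closed_sequentially[OF closed_cmat_subspace[OF A]] s a(1) by blast
  with a(2) show "\<exists>a\<in>A. (\<lambda>k. op_norm (s k - a)) \<longlonglongrightarrow> 0"
    by blast
qed (use assms in \<open>auto simp: matrix_mul_assoc matrix_add_ldistrib matrix_mult_add_left
    cmat_scale_mult_left cmat_scale_mult_right conj_transpose_mult op_norm_nonneg op_norm_eq_0_iff op_norm_triangle op_norm_scale
    op_norm_mult op_norm_cstar_identity\<close>,
    simp_all add: conj_transpose_def cmat_scale_def vec_eq_iff)


section \<open>The commutant of a set of unitary matrices\<close>

definition commutant :: "('a::semiring_1^'i^'i) set \<Rightarrow> ('a^'i^'i) set" where
  "commutant S = {M. \<forall>P\<in>S. P ** M = M ** P}"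

lemma subspace_commutant: "cmat.subspace (commutant S)"
proof (rule cmat.subspaceI)
  fix M N and z
  assume M: "M \<in> commutant S"
  then show "cmat_scale z M \<in> commutant S"
    by (simp add: commutant_def cmat_scale_mult_left cmat_scale_mult_right)
  assume "N \<in> commutant S"
  with M show "M + N \<in> commutant S"
    by (simp add: commutant_def matrix_add_ldistrib matrix_mult_add_left)
qed (simp add: commutant_def)

lemma commutant_mult: "\<lbrakk>M \<in> commutant S; N \<in> commutant S\<rbrakk> \<Longrightarrow> M ** N \<in> commutant S"
  by (simp add: commutant_def) (metis matrix_mul_assoc)

text \<open>
  A matrix that commutes with the unitary \<open>P\<close> commutes with \<open>P\<inverse> = P\<^sup>*\<close>;
  take adjoints.
\<close>

lemma commutant_conj_transpose:
  fixes S :: "(complex^'i::finite^'i) set"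
  assumes unitary: "\<And>P. P \<in> S \<Longrightarrow> P ** conj_transpose P = mat 1"
    and M: "M \<in> commutant S"
  shows "conj_transpose M \<in> commutant S"
proof -
  have "P ** conj_transpose M = conj_transpose M ** P" if P: "P \<in> S" for P
  proof -
    have PP: "P ** conj_transpose P = mat 1" "conj_transpose P ** P = mat 1"
      using unitary[OF P] by (simp_all add: matrix_left_right_inverse)
    have "M ** conj_transpose P = conj_transpose P ** (P ** M) ** conj_transpose P"
      by (simp add: matrix_mul_assoc PP)
    also have "\<dots> = conj_transpose P ** (M ** P) ** conj_transpose P"
      using M P by (simp add: commutant_def)
    also have "\<dots> = conj_transpose P ** M"
      by (metis matrix_mul_assoc matrix_mul_rid PP(1))
    finally show ?thesis
      by (metis conj_transpose_mult conj_transpose_conj_transpose)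
  qed
  then show ?thesis
    by (simp add: commutant_def)
qed


section \<open>Modified cocyclic matrices as a commutant\<close>

locale root_cocycle = group G for G :: "'g::finite monoid" (structure) +
  fixes n :: nat and \<omega> :: "'g \<Rightarrow> 'g \<Rightarrow> complex"
  assumes carrier_UNIV: "carrier G = UNIV"
    and n_pos: "n \<ge> 1"
    and cocycle: "\<omega> \<in> two_cocycles G n"
begin

lemma mem_carrier [simp, intro]: "x \<in> carrier G"
  by (simp add: carrier_UNIV)

lemma cmod_cocycle: "cmod (\<omega> x y) = 1"
proof -
  have "\<omega> x y ^ n = 1"
    using cocycle by (auto simp: two_cocycles_def roots_mu_def)
  then show ?thesis
    using n_pos power_eq_1_iff by fastforce
qed

lemma cocycle_mult_cnj [simp]: "\<omega> x y * cnj (\<omega> x y) = 1"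
  by (simp add: complex_norm_square[symmetric] cmod_cocycle)

lemma cocycle_nonzero [simp]: "\<omega> x y \<noteq> 0"
  using cmod_cocycle[of x y] by auto

lemma cocycle_identity: "\<omega> y z * \<omega> x (y \<otimes> z) = \<omega> (x \<otimes> y) z * \<omega> x y"
proof -
  have "\<omega> y z * inverse (\<omega> (x \<otimes> y) z) * \<omega> x (y \<otimes> z) * inverse (\<omega> x y) = 1"
    using cocycle by (simp add: two_cocycles_def)
  then show ?thesis
    by (simp add: field_simps)
qed

lemma C'_matrix_nonzero [simp]: "C'_matrix G \<omega> $ x $ y \<noteq> 0"
  by (simp add: C'_matrix_def)

text \<open>
  Multiply out the denominators.  The cocycle identity for the triple
  \<open>(x\<inverse>, g\<inverse>, g y)\<close> handles the numerators of \<open>C(x, y)\<close> and \<open>C(g x, g y)\<close>, and the one for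
  \<open>(y\<inverse>, g\<inverse>, g y)\<close> handles their denominators; both produce the same factor
  \<open>\<omega>(g\<inverse>, g y)\<close>, which cancels.
\<close>

lemma C'_matrix_translate:
  "\<omega> (inv x) (inv g) * C'_matrix G \<omega> $ (g \<otimes> x) $ (g \<otimes> y)
    = C'_matrix G \<omega> $ x $ y * \<omega> (inv y) (inv g)"
proof -
  have y: "inv g \<otimes> (g \<otimes> y) = y"
    by (simp add: m_assoc[symmetric])
  have num: "\<omega> (inv g) (g \<otimes> y) * \<omega> (inv x) y = \<omega> (inv x \<otimes> inv g) (g \<otimes> y) * \<omega> (inv x) (inv g)"
    and den: "\<omega> (inv g) (g \<otimes> y) * \<omega> (inv y) y = \<omega> (inv y \<otimes> inv g) (g \<otimes> y) * \<omega> (inv y) (inv g)"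
    using cocycle_identity[of "inv g" "g \<otimes> y" "inv x"] cocycle_identity[of "inv g" "g \<otimes> y" "inv y"]
    by (simp_all only: y)
  have "\<omega> (inv x) (inv g) * \<omega> (inv x \<otimes> inv g) (g \<otimes> y) * \<omega> (inv y) y
      = \<omega> (inv x) y * (\<omega> (inv g) (g \<otimes> y) * \<omega> (inv y) y)"
    by (metis num mult.assoc mult.commute)
  then have "\<omega> (inv x) (inv g) * \<omega> (inv x \<otimes> inv g) (g \<otimes> y) * \<omega> (inv y) y
      = \<omega> (inv x) y * \<omega> (inv y) (inv g) * \<omega> (inv y \<otimes> inv g) (g \<otimes> y)"
    by (simp only: den) (simp only: mult_ac)
  then show ?thesis
    by (simp add: C'_matrix_def inv_mult_group field_simps)
qed

text \<open>
  By the cocycle identity the matrix for \<open>(g h)\<inverse>\<close>, multiplied by \<open>\<omega>(g, h)\<close>, is the product of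
  those for \<open>g\<inverse>\<close> and \<open>h\<inverse>\<close>. So this is the left regular \<open>\<omega>\<close>-projective representation of \<open>G\<close>,
  up to inversion of the argument.
\<close>

definition twisted_translation :: "'g \<Rightarrow> complex^'g^'g" where
  "twisted_translation g = (\<chi> x z. if z = g \<otimes> x then \<omega> (inv x) (inv g) else 0)"

lemma twisted_translation_unitary:
  "twisted_translation g ** conj_transpose (twisted_translation g) = mat 1"
proof -
  have "(\<Sum>z\<in>UNIV. (if z = g \<otimes> x then \<omega> (inv x) (inv g) else 0)
          * cnj (if z = g \<otimes> y then \<omega> (inv y) (inv g) else 0)) = (if x = y then 1 else 0)" for x y
    by (simp add: if_distrib[of "\<lambda>c. c * _"] if_distrib[of cnj] cong: if_cong)
  then show ?thesis
    by (simp add: matrix_matrix_mult_def conj_transpose_def twisted_translation_def mat_def vec_eq_iff)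
qed

lemma mem_commutant_twisted_translation_iff:
  "M \<in> commutant (range twisted_translation) \<longleftrightarrow>
    (\<forall>g x y. \<omega> (inv x) (inv g) * M $ (g \<otimes> x) $ (g \<otimes> y) = M $ x $ y * \<omega> (inv y) (inv g))"
proof -
  have left: "(twisted_translation g ** M) $ x $ (g \<otimes> y)
      = \<omega> (inv x) (inv g) * M $ (g \<otimes> x) $ (g \<otimes> y)" for g x y
    by (simp add: matrix_matrix_mult_def twisted_translation_def if_distrib[of "\<lambda>c. c * _"] cong: if_cong)
  have right: "(M ** twisted_translation g) $ x $ (g \<otimes> y) = M $ x $ y * \<omega> (inv y) (inv g)" for g x y
    by (simp add: matrix_matrix_mult_def twisted_translation_def if_distrib[of "\<lambda>c. _ * c"] cong: if_cong)
  have col: "w = g \<otimes> (inv g \<otimes> w)" for g w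
    by (simp add: m_assoc[symmetric])
  have "twisted_translation g ** M = M ** twisted_translation g \<longleftrightarrow>
      (\<forall>x y. (twisted_translation g ** M) $ x $ (g \<otimes> y) = (M ** twisted_translation g) $ x $ (g \<otimes> y))" for g
    unfolding vec_eq_iff by (metis col)
  then show ?thesis
    by (simp add: commutant_def left right)
qed

lemma entrywise_mult_C'_matrix_mem_commutant_iff:
  "entrywise_mult K (C'_matrix G \<omega>) \<in> commutant (range twisted_translation) \<longleftrightarrow> G_invariant G K"
proof -
  let ?C = "C'_matrix G \<omega>"
  have "\<omega> (inv x) (inv g) * (K $ (g \<otimes> x) $ (g \<otimes> y) * ?C $ (g \<otimes> x) $ (g \<otimes> y))
          = K $ x $ y * ?C $ x $ y * \<omega> (inv y) (inv g)
      \<longleftrightarrow> K $ (g \<otimes> x) $ (g \<otimes> y) = K $ x $ y" for g x y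
  proof -
    have "\<omega> (inv x) (inv g) * (K $ (g \<otimes> x) $ (g \<otimes> y) * ?C $ (g \<otimes> x) $ (g \<otimes> y))
        = K $ (g \<otimes> x) $ (g \<otimes> y) * (?C $ x $ y * \<omega> (inv y) (inv g))"
      by (metis C'_matrix_translate mult.left_commute)
    then show ?thesis
      by (simp only: mult.assoc) simp
  qed
  then show ?thesis
    by (simp add: mem_commutant_twisted_translation_iff entrywise_mult_def G_invariant_def carrier_UNIV)
qed


section \<open>A basis of modified cocyclic matrices\<close>

definition cocyclic_basis :: "'g \<Rightarrow> complex^'g^'g" where
  "cocyclic_basis g = entrywise_mult (\<chi> x y. of_bool (inv x \<otimes> y = g)) (C'_matrix G \<omega>)"

lemma cocyclic_basis_modified_cocyclic: "cocyclic_basis g \<in> modified_cocyclic G n \<omega>"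
proof -
  have "inv (h \<otimes> x) \<otimes> (h \<otimes> y) = inv x \<otimes> y" for h x y
    by (metis inv_mult_group inv_solve_left m_assoc m_closed inv_closed mem_carrier)
  then have "G_invariant G (\<chi> x y. of_bool (inv x \<otimes> y = g))"
    by (simp add: G_invariant_def)
  then show ?thesis
    unfolding modified_cocyclic_def cocyclic_basis_def
    by (intro CollectI exI[of _ "\<chi> x y. of_bool (inv x \<otimes> y = g)"])
      (simp add: roots_mu_plus_def roots_mu_def)
qed

text \<open>
  In the row of \<open>\<one>\<close>, the matrix \<open>cocyclic_basis g\<close> has a single nonzero entry, in column \<open>g\<close>,
  so the coefficients of a linear combination can be read off that row.
\<close>

lemma sum_cocyclic_basis_row_one:
  "(\<Sum>g\<in>UNIV. cmat_scale (c g) (cocyclic_basis g)) $ \<one> $ h = c h * C'_matrix G \<omega> $ \<one> $ h"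
  by (simp add: cocyclic_basis_def entrywise_mult_def cmat_scale_def sum_component
      of_bool_def if_distrib[of "\<lambda>c. _ * c"] if_distrib[of "\<lambda>c. c * _"] cong: if_cong)

lemma inj_cocyclic_basis: "inj cocyclic_basis"
proof (rule injI)
  fix g h
  assume "cocyclic_basis g = cocyclic_basis h"
  then have "cocyclic_basis g $ \<one> $ g = cocyclic_basis h $ \<one> $ g"
    by simp
  then show "g = h"
    by (simp add: cocyclic_basis_def entrywise_mult_def split: if_splits)
qed

lemma independent_cocyclic_basis: "cmat.independent (range cocyclic_basis)"
proof (rule cmat.independent_if_scalars_zero)
  fix u M
  assume sum: "(\<Sum>M\<in>range cocyclic_basis. cmat_scale (u M) M) = 0" and M: "M \<in> range cocyclic_basis"
  obtain h where h: "M = cocyclic_basis h"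
    using M by blast
  have "(\<Sum>g\<in>UNIV. cmat_scale (u (cocyclic_basis g)) (cocyclic_basis g)) = 0"
    using sum by (simp add: sum.reindex[OF inj_cocyclic_basis])
  then have "u M * C'_matrix G \<omega> $ \<one> $ h = 0"
    unfolding h by (metis sum_cocyclic_basis_row_one zero_index)
  then show "u M = 0"
    by simp
qed simp

lemma entrywise_mult_C'_matrix_in_span:
  assumes K: "G_invariant G K"
  shows "entrywise_mult K (C'_matrix G \<omega>) \<in> cmat.span (range cocyclic_basis)"
proof -
  have K_row: "K $ \<one> $ (inv x \<otimes> y) = K $ x $ y" for x y
  proof -
    have "K $ (x \<otimes> \<one>) $ (x \<otimes> (inv x \<otimes> y)) = K $ \<one> $ (inv x \<otimes> y)"
      using K unfolding G_invariant_def by blast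
    then show ?thesis
      by (simp add: m_assoc[symmetric])
  qed
  have "entrywise_mult K (C'_matrix G \<omega>) = (\<Sum>g\<in>UNIV. cmat_scale (K $ \<one> $ g) (cocyclic_basis g))"
    by (simp add: vec_eq_iff entrywise_mult_def cocyclic_basis_def cmat_scale_def sum_component K_row
        of_bool_def if_distrib[of "\<lambda>c. _ * c"] if_distrib[of "\<lambda>c. c * _"] cong: if_cong)
  also have "\<dots> \<in> cmat.span (range cocyclic_basis)"
    by (intro cmat.span_sum cmat.span_scale cmat.span_base) simp
  finally show ?thesis .
qed

lemma commutant_eq_span_cocyclic_basis:
  "commutant (range twisted_translation) = cmat.span (range cocyclic_basis)"
proof
  show "commutant (range twisted_translation) \<subseteq> cmat.span (range cocyclic_basis)"
  proof
    fix M
    assume M: "M \<in> commutant (range twisted_translation)"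
    define K where "K = (\<chi> x y. M $ x $ y / C'_matrix G \<omega> $ x $ y)"
    have "M = entrywise_mult K (C'_matrix G \<omega>)"
      by (simp add: K_def entrywise_mult_def vec_eq_iff)
    with M show "M \<in> cmat.span (range cocyclic_basis)"
      using entrywise_mult_C'_matrix_mem_commutant_iff entrywise_mult_C'_matrix_in_span by metis
  qed
next
  have "modified_cocyclic G n \<omega> \<subseteq> commutant (range twisted_translation)"
    by (auto simp: modified_cocyclic_def entrywise_mult_C'_matrix_mem_commutant_iff)
  then have "range cocyclic_basis \<subseteq> commutant (range twisted_translation)"
    using cocyclic_basis_modified_cocyclic by blast
  then show "cmat.span (range cocyclic_basis) \<subseteq> commutant (range twisted_translation)"
    by (rule cmat.span_minimal[OF _ subspace_commutant])
qed

lemma span_modified_cocyclic: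
  "cmat.span (modified_cocyclic G n \<omega>) = cmat.span (range cocyclic_basis)"
  unfolding cmat.span_eq
proof
  show "modified_cocyclic G n \<omega> \<subseteq> cmat.span (range cocyclic_basis)"
    using entrywise_mult_C'_matrix_in_span by (auto simp: modified_cocyclic_def)
  show "range cocyclic_basis \<subseteq> cmat.span (modified_cocyclic G n \<omega>)"
    using cocyclic_basis_modified_cocyclic cmat.span_base by blast
qed

lemma cstar_algebra_span_modified_cocyclic:
  "cstar_algebra_on cmat_scale (cmat.span (modified_cocyclic G n \<omega>)) (**) conj_transpose op_norm"
  unfolding span_modified_cocyclic commutant_eq_span_cocyclic_basis[symmetric]
  by (intro cstar_algebra_on_cmat subspace_commutant commutant_mult commutant_conj_transpose)
    (auto simp: twisted_translation_unitary)

lemma dim_span_modified_cocyclic: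
  "cmat.dim (cmat.span (modified_cocyclic G n \<omega>)) = card (carrier G)"
  unfolding span_modified_cocyclic carrier_UNIV
  using cmat.dim_span_eq_card_independent[OF independent_cocyclic_basis]
  by (simp only: card_image[OF inj_cocyclic_basis])

end

theorem theorem7p11:
  fixes G :: "'g::finite monoid" and n :: nat and \<omega> :: "'g \<Rightarrow> 'g \<Rightarrow> complex"
  assumes "group G" and "carrier G = UNIV"
    and "n \<ge> 1"
    and "\<omega> \<in> two_cocycles G n"
  shows "cstar_algebra_on cmat_scale (cmat.span (modified_cocyclic G n \<omega>))
           (**) conj_transpose op_norm
       \<and> cmat.dim (cmat.span (modified_cocyclic G n \<omega>)) = card (carrier G)"
proof -
  interpret root_cocycle G n \<omega>
    using assms by (simp add: root_cocycle_def root_cocycle_axioms_def)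
  show ?thesis
    using cstar_algebra_span_modified_cocyclic dim_span_modified_cocyclic by blast
qed

end
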